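(* Let $n\ge 2$ and $1\le k\le n-1$. The Laplacian spectrum of the enhanced hypercube $Q_{n,k}$ is \[\mathrm{Spec}_L(Q_{n,k})=\{0,\ [2]^{k-1},\ [2t+2]^{\gamma_t}\ (t=1,\dots,n-1),\ [2n+2]^{\gamma_n}\},\] where $\gamma_t=\sum_{j=0}^{n}{n-k+2\choose 2j}{k-1\choose t+1-2j}$ for $1\le t\le n-1$ and $\gamma_n=\sum_{j=1}^{n}{n-k+1\choose 2j-1}{k-1\choose n-2j+1}$.
   Context: For $n\ge 2$ and $1\le k\le n-1$, the enhanced hypercube $Q_{n,k}$ is the simple graph whose vertices are the binary strings $x_1x_2\cdots x_n$ ($x_i\in\{0,1\}$), where $X=x_1\cdots x_n$ and $Y$ are adjacent iff either $Y$ is obtained from $X$ by complementing exactly one coordinate ($1\le i\le n$), or $Y=x_1\cdots x_{k-1}\overline{x_k}\,\overline{x_{k+1}}\cdots\overline{x_n}$. The Laplacian matrix is $L=D-A$ ($D$ the diagonal degree matrix, $A$ the adjacency matrix); the Laplacian spectrum is the multiset of its eigenvalues, and $[\mu]^m$ denotes eigenvalue $\mu$ with multiplicity $m$ (multiplicity $0$ meaning $\mu$ does not occur). Binomial coefficients ${a\choose b}$ are $0$ when $b<0$ or $b>a$. *)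

theory Defs
  imports
    "HOL-Computational_Algebra.Computational_Algebra"
    "Graph_Theory.Pair_Digraph"
    "Jordan_Normal_Form.Char_Poly"
begin

(* A string x_1 ... x_n is a bool list, so x_i is xs ! (i - 1). *)

definition flip_coord :: "nat \<Rightarrow> bool list \<Rightarrow> bool list" where
  "flip_coord i xs = xs[i - 1 := \<not> xs ! (i - 1)]"

definition flip_from :: "nat \<Rightarrow> bool list \<Rightarrow> bool list" where
  "flip_from k xs = take (k - 1) xs @ map Not (drop (k - 1) xs)"

(* A simple graph is represented, as in Graph_Theory, by a symmetric loopfree digraph
   without parallel arcs (locale pair_graph). *)
definition enhanced_hypercube :: "nat \<Rightarrow> nat \<Rightarrow> bool list pair_pre_digraph" where
  "enhanced_hypercube n k =
     \<lparr> pverts = {xs. length xs = n},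
       parcs = {(xs, ys). length xs = n \<and>
                  ((\<exists>i\<in>{1..n}. ys = flip_coord i xs) \<or> ys = flip_from k xs)} \<rparr>"

lemma flip_coord_props:
  "length (flip_coord i xs) = length xs"
  "i \<in> {1..length xs} \<Longrightarrow> flip_coord i (flip_coord i xs) = xs"
  "i \<in> {1..length xs} \<Longrightarrow> flip_coord i xs \<noteq> xs"
proof -
  show "length (flip_coord i xs) = length xs"
    by (simp add: flip_coord_def)
  assume i: "i \<in> {1..length xs}"
  then have i': "i - 1 < length xs" by auto
  then show "flip_coord i (flip_coord i xs) = xs"
    by (simp add: flip_coord_def)
  have "flip_coord i xs ! (i - 1) \<noteq> xs ! (i - 1)"
    using i' by (simp add: flip_coord_def)
  then show "flip_coord i xs \<noteq> xs" by metis
qed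

lemma flip_from_props:
  "length (flip_from k xs) = length xs"
  "flip_from k (flip_from k xs) = xs"
  "k \<in> {1..length xs} \<Longrightarrow> flip_from k xs \<noteq> xs"
proof -
  show "length (flip_from k xs) = length xs"
    by (simp add: flip_from_def)
  show "flip_from k (flip_from k xs) = xs"
    by (cases "k - 1 \<le> length xs") (simp_all add: flip_from_def comp_def)
  assume "k \<in> {1..length xs}"
  then have "k - 1 < length xs" by auto
  then have "flip_from k xs ! (k - 1) \<noteq> xs ! (k - 1)"
    by (simp add: flip_from_def nth_append)
  then show "flip_from k xs \<noteq> xs" by metis
qed

lemma finite_bool_lists: "finite {xs :: bool list. length xs = n}"
  using finite_lists_length_eq[of "UNIV :: bool set" n] by simp

lemma pair_graph_enhanced_hypercube:
  assumes "1 \<le> k" "k \<le> n - 1"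
  shows "pair_graph (enhanced_hypercube n k)"
proof -
  let ?G = "enhanced_hypercube n k"
  have wf: "fst e \<in> pverts ?G" "snd e \<in> pverts ?G" "fst e \<noteq> snd e" if "e \<in> parcs ?G" for e
  proof -
    obtain xs ys where e: "e = (xs, ys)" by (cases e)
    with that have len: "length xs = n"
      and step: "(\<exists>i\<in>{1..n}. ys = flip_coord i xs) \<or> ys = flip_from k xs"
      by (auto simp: enhanced_hypercube_def)
    from assms len have "k \<in> {1..length xs}" by auto
    with step len have "ys \<noteq> xs" "length ys = n"
      using flip_coord_props(1,3) flip_from_props(1,3) by metis+
    with e len show "fst e \<in> pverts ?G" "snd e \<in> pverts ?G" "fst e \<noteq> snd e"
      by (auto simp: enhanced_hypercube_def)
  qed
  have fin: "finite (pverts ?G)"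
    by (simp add: enhanced_hypercube_def finite_bool_lists)
  have "parcs ?G \<subseteq> pverts ?G \<times> pverts ?G"
    using wf by (auto simp: mem_Times_iff)
  then have "finite (parcs ?G)"
    using fin by (meson finite_SigmaI finite_subset)
  moreover have "sym (parcs ?G)"
  proof (rule symI)
    fix xs ys assume "(xs, ys) \<in> parcs ?G"
    then have len: "length xs = n"
      and step: "(\<exists>i\<in>{1..n}. ys = flip_coord i xs) \<or> ys = flip_from k xs"
      by (auto simp: enhanced_hypercube_def)
    from step have "(\<exists>i\<in>{1..n}. xs = flip_coord i ys) \<or> xs = flip_from k ys"
    proof
      assume "\<exists>i\<in>{1..n}. ys = flip_coord i xs"
      then obtain i where i: "i \<in> {1..n}" "ys = flip_coord i xs" ..
      then have "xs = flip_coord i ys"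
        using len by (simp only: flip_coord_props(2))
      with i(1) show ?thesis by blast
    next
      assume "ys = flip_from k xs"
      then show ?thesis by (simp add: flip_from_props(2))
    qed
    moreover have "length ys = n"
      using step len flip_coord_props(1) flip_from_props(1) by auto
    ultimately show "(ys, xs) \<in> parcs ?G"
      by (simp add: enhanced_hypercube_def)
  qed
  ultimately show ?thesis
    using wf fin by unfold_locales (auto simp: symmetric_def)
qed

(* Matrices are indexed by natural numbers, so they depend on an enumeration vs of the
   vertices: row and column i belong to the vertex vs ! i. *)

definition degree_matrix :: "'v pair_pre_digraph \<Rightarrow> 'v list \<Rightarrow> complex mat" where
  "degree_matrix G vs = mat (length vs) (length vs)
     (\<lambda>(i, j). if i = j then of_nat (out_degree (with_proj G) (vs ! i)) else 0)"

definition adjacency_matrix :: "'v pair_pre_digraph \<Rightarrow> 'v list \<Rightarrow> complex mat" where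
  "adjacency_matrix G vs = mat (length vs) (length vs)
     (\<lambda>(i, j). if (vs ! i, vs ! j) \<in> parcs G then 1 else 0)"

definition laplacian_matrix :: "'v pair_pre_digraph \<Rightarrow> 'v list \<Rightarrow> complex mat" where
  "laplacian_matrix G vs = degree_matrix G vs - adjacency_matrix G vs"

(* The eigenvalues counted with algebraic multiplicity. *)
definition laplacian_spectrum :: "'v pair_pre_digraph \<Rightarrow> 'v list \<Rightarrow> complex multiset" where
  "laplacian_spectrum G vs = proots (char_poly (laplacian_matrix G vs))"

(* The lower argument is an integer: truncated subtraction on nat would turn the
   vanishing coefficients with negative lower argument into 1. *)
definition binom :: "nat \<Rightarrow> int \<Rightarrow> nat" where
  "binom a b = (if b < 0 then 0 else a choose nat b)"

definition gamma_mid :: "nat \<Rightarrow> nat \<Rightarrow> nat \<Rightarrow> nat" where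
  "gamma_mid n k t =
     (\<Sum>j=0..n. binom (n - k + 2) (2 * int j) * binom (k - 1) (int t + 1 - 2 * int j))"

definition gamma_last :: "nat \<Rightarrow> nat \<Rightarrow> nat" where
  "gamma_last n k =
     (\<Sum>j=1..n. binom (n - k + 1) (2 * int j - 1) * binom (k - 1) (int n - 2 * int j + 1))"

end

theory Submission
  imports Defs
begin

text \<open>The vertices form the group of binary vectors and the enhanced hypercube is a Cayley graph
  on it, so its characters \<open>x \<mapsto> (-1) ^ (x \<bullet> y)\<close> diagonalise the Laplacian. If \<open>y\<close> has
  weight \<open>a\<close> on the first \<open>k - 1\<close> coordinates and weight \<open>b\<close> on the others, then its eigenvalue is
  \<open>2 * (a + b) + 1 - (-1) ^ b\<close>, that is \<open>2 * (a + 2 * j)\<close> where \<open>2 * j\<close> is \<open>b\<close> rounded up to an even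
  number. By Pascal's rule \<open>(n - k + 2) choose (2 * j)\<close> tails have a weight \<open>b\<close> that rounds up
  to \<open>2 * j\<close>.\<close>

subsection \<open>Spectra from eigenbases\<close>

lemma proots_prod_list_linear:
  "proots (\<Prod>a\<leftarrow>as. [:- a, 1:]) = mset (as :: 'a :: idom list)"
proof (induction as)
  case (Cons a as)
  have "(\<Prod>a\<leftarrow>as. [:- a, 1:]) \<noteq> 0"
    by (auto simp: prod_list_zero_iff)
  with Cons show ?case
    by (simp add: proots_mult proots_linear_factor del: mult_pCons_left)
qed simp

text \<open>The columns of \<open>P\<close> are eigenvectors and \<open>Q\<close> witnesses their
  independence, so \<open>A\<close> is similar to a diagonal matrix. Passing through the
  characteristic polynomial yields the algebraic multiplicities.\<close>

lemma proots_char_poly_eigenbasis: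
  fixes A :: "'a :: field mat"
  assumes A: "A \<in> carrier_mat N N" and P: "P \<in> carrier_mat N N" and Q: "Q \<in> carrier_mat N N"
    and PQ: "P * Q = 1\<^sub>m N" and AP: "A * P = P * mat_diag N d"
  shows "proots (char_poly A) = mset (map d [0..<N])"
proof -
  have D: "mat_diag N d \<in> carrier_mat N N" by (simp add: mat_diag_def)
  have QP: "Q * P = 1\<^sub>m N" by (rule mat_mult_left_right_inverse[OF P Q PQ])
  have "A = A * (P * Q)" using A PQ by simp
  also have "\<dots> = P * mat_diag N d * Q"
    using A P Q by (simp add: AP flip: assoc_mult_mat)
  finally have "similar_mat_wit A (mat_diag N d) P Q"
    using A P Q D PQ QP by (intro similar_mat_witI)
  then have "char_poly A = char_poly (mat_diag N d)"
    using char_poly_similar similar_mat_def by blast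
  also have "\<dots> = (\<Prod>a\<leftarrow>diag_mat (mat_diag N d). [:- a, 1:])"
    by (rule char_poly_upper_triangular[OF D]) (auto simp: mat_diag_def)
  also have "diag_mat (mat_diag N d) = map d [0..<N]"
    by (auto simp: diag_mat_def mat_diag_def)
  finally show ?thesis by (simp only: proots_prod_list_linear)
qed

subsection \<open>Characters of the group of binary vectors\<close>

abbreviation weight :: "bool list \<Rightarrow> nat" where
  "weight xs \<equiv> length (filter (\<lambda>b. b) xs)"

text \<open>The product form of (-1) to the dot product of \<open>x\<close> and \<open>y\<close>:
  complementing coordinates of \<open>x\<close> then acts factor by factor.\<close>

definition character :: "nat \<Rightarrow> bool list \<Rightarrow> bool list \<Rightarrow> complex" where
  "character n y x = (\<Prod>i<n. if y ! i \<and> x ! i then - 1 else 1)"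

lemma character_commute: "character n y x = character n x y"
  by (simp add: character_def conj_commute)

lemma character_square: "character n y x * character n y x = 1"
  by (auto simp: character_def simp flip: prod.distrib intro: prod.neutral)

lemma character_flip_coord:
  assumes "length x = n" and "i \<in> {1..n}"
  shows "character n y (flip_coord i x) = (if y ! (i - 1) then - 1 else 1) * character n y x"
proof -
  \<comment> \<open>\<open>?h j\<close> is the ratio of the new factor to the old one at position
    \<open>j\<close>; it can differ from 1 only at the flipped position.\<close>
  let ?h = "\<lambda>j. if j = i - 1 then (if y ! j then - 1 else 1) else (1 :: complex)"
  have "character n y (flip_coord i x) = (\<Prod>j<n. ?h j * (if y ! j \<and> x ! j then - 1 else 1))"
    unfolding character_def
    using assms by (intro prod.cong) (auto simp: flip_coord_def nth_list_update)
  also have "\<dots> = (\<Prod>j<n. ?h j) * character n y x"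
    by (simp add: prod.distrib character_def)
  also have "(\<Prod>j<n. ?h j) = (if y ! (i - 1) then - 1 else 1)"
    using assms(2) by (subst prod.delta) auto
  finally show ?thesis .
qed

lemma prod_sign_eq_weight:
  "(\<Prod>i = 0..<length ys. if ys ! i then - 1 else 1) = (- 1 :: 'a :: comm_ring_1) ^ weight ys"
proof -
  have "(\<Prod>i = 0..<length ys. if ys ! i then - 1 else 1) = (\<Prod>b\<leftarrow>ys. if b then - 1 else (1 :: 'a))"
    by (simp add: prod.list_conv_set_nth)
  also have "\<dots> = (- 1) ^ weight ys"
    by (induction ys) auto
  finally show ?thesis .
qed

lemma sum_sign_eq_weight:
  "(\<Sum>i = 0..<length ys. if ys ! i then - 1 else 1)
    = of_nat (length ys) - (2 :: 'a :: comm_ring_1) * of_nat (weight ys)"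
proof -
  have "(\<Sum>i = 0..<length ys. if ys ! i then - 1 else 1) = (\<Sum>b\<leftarrow>ys. if b then - 1 else (1 :: 'a))"
    by (simp add: sum.list_conv_set_nth)
  also have "\<dots> = of_nat (length ys) - 2 * of_nat (weight ys)"
    by (induction ys) (auto simp: algebra_simps)
  finally show ?thesis .
qed

lemma character_flip_from:
  assumes "length x = n" and "length y = n" and "k \<le> n"
  shows "character n y (flip_from k x) = (- 1) ^ weight (drop (k - 1) y) * character n y x"
proof -
  let ?h = "\<lambda>j. if k - 1 \<le> j then (if y ! j then - 1 else 1) else (1 :: complex)"
  have "character n y (flip_from k x) = (\<Prod>j<n. ?h j * (if y ! j \<and> x ! j then - 1 else 1))"
    unfolding character_def
    using assms by (intro prod.cong) (auto simp: flip_from_def nth_append)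
  also have "\<dots> = (\<Prod>j<n. ?h j) * character n y x"
    by (simp add: prod.distrib character_def)
  also have "(\<Prod>j<n. ?h j) = (\<Prod>j = k - 1..<n. if y ! j then - 1 else 1)"
    by (rule prod.mono_neutral_cong_right) auto
  also have "\<dots> = (\<Prod>j = 0..<length (drop (k - 1) y). if drop (k - 1) y ! j then - 1 else 1)"
    using assms by (subst prod.atLeastLessThan_shift_0) (auto intro!: prod.cong)
  also have "\<dots> = (- 1) ^ weight (drop (k - 1) y)"
    by (rule prod_sign_eq_weight)
  finally show ?thesis .
qed

lemma card_bool_lists: "card {xs :: bool list. length xs = n} = 2 ^ n"
  using card_lists_length_eq[of "UNIV :: bool set" n] by simp

text \<open>For distinct characters a sign-reversing involution makes the sum equal to its own
  negative. This orthogonality provides the inverse of the character matrix.\<close>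

lemma sum_character_mult:
  assumes y: "length y = n" and z: "length z = n"
  shows "(\<Sum>x | length x = n. character n y x * character n z x) = (if y = z then 2 ^ n else 0)"
proof (cases "y = z")
  case True
  then show ?thesis by (simp add: character_square card_bool_lists)
next
  case False
  then obtain i where i: "i < n" "y ! i \<noteq> z ! i"
    using y z by (auto simp: list_eq_iff_nth_eq)
  let ?f = "\<lambda>x. character n y x * character n z x"
  \<comment> \<open>Flipping coordinate \<open>i\<close> changes the sign of exactly one of the two characters.\<close>
  have flip: "?f (flip_coord (Suc i) x) = - ?f x" if "length x = n" for x
    using i that by (auto simp: character_flip_coord)
  have "sum ?f {x. length x = n} = (\<Sum>x | length x = n. ?f (flip_coord (Suc i) x))"
    using i(1)
    by (intro sum.reindex_bij_witness[where i = "flip_coord (Suc i)" and j = "flip_coord (Suc i)"])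
      (auto simp: flip_coord_props)
  also have "\<dots> = - sum ?f {x. length x = n}"
    using flip by (simp add: sum_negf)
  finally show ?thesis using False by simp
qed

subsection \<open>The Laplacian on characters\<close>

lemma flip_coord_inj:
  assumes "i \<in> {1..length xs}" "j \<in> {1..length xs}" "flip_coord i xs = flip_coord j xs"
  shows "i = j"
proof (rule ccontr)
  assume "i \<noteq> j"
  then have ij: "i - 1 \<noteq> j - 1" using assms by auto
  have "i - 1 < length xs" using assms by auto
  then have "flip_coord i xs ! (i - 1) \<noteq> xs ! (i - 1)"
    by (simp add: flip_coord_def)
  moreover have "flip_coord j xs ! (i - 1) = xs ! (i - 1)"
    using ij by (metis flip_coord_def nth_list_update_neq)
  ultimately show False using assms by simp
qed

text \<open>The coordinates \<open>k\<close> and \<open>k + 1\<close> both change under \<open>flip_from k\<close>.\<close>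
lemma flip_from_neq_flip_coord:
  assumes "1 \<le> k" "k < length xs"
  shows "flip_from k xs \<noteq> flip_coord i xs"
proof
  assume eq: "flip_from k xs = flip_coord i xs"
  obtain j where j: "j \<in> {k - 1, k}" "j \<noteq> i - 1"
    using assms(1) by (metis diff_is_0_eq' diff_less insertCI less_irrefl_nat less_numeral_extra(1)
      less_le_trans)
  then have "flip_from k xs ! j \<noteq> xs ! j"
    using assms by (auto simp: flip_from_def nth_append)
  moreover have "flip_coord i xs ! j = xs ! j"
    using j by (simp add: flip_coord_def)
  ultimately show False using eq by simp
qed

text \<open>The n + 1 neighbours are pairwise distinct, which relies on k < n: for k = n,
  \<open>flip_from\<close> would coincide with the flip of coordinate n. A constant \<open>f\<close>
  gives the degree, a character gives the action of the adjacency matrix.\<close>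

lemma sum_neighbours:
  assumes "1 \<le> k" "k \<le> n - 1" "length x = n"
  shows "(\<Sum>x' | (x, x') \<in> parcs (enhanced_hypercube n k). f x')
    = f (flip_from k x) + (\<Sum>i = 1..n. f (flip_coord i x))"
proof -
  have "{x'. (x, x') \<in> parcs (enhanced_hypercube n k)}
      = insert (flip_from k x) ((\<lambda>i. flip_coord i x) ` {1..n})"
    using assms by (auto simp: enhanced_hypercube_def)
  moreover have "flip_from k x \<notin> (\<lambda>i. flip_coord i x) ` {1..n}"
    using flip_from_neq_flip_coord[of k x] assms by fastforce
  moreover have "inj_on (\<lambda>i. flip_coord i x) {1..n}"
    using flip_coord_inj[of _ x] assms by (auto intro: inj_onI)
  ultimately show ?thesis by (simp add: sum.reindex)
qed

lemma out_degree_enhanced_hypercube: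
  assumes "1 \<le> k" "k \<le> n - 1" "length x = n"
  shows "out_degree (with_proj (enhanced_hypercube n k)) x = n + 1"
proof -
  have "out_arcs (with_proj (enhanced_hypercube n k)) x
      = Pair x ` {x'. (x, x') \<in> parcs (enhanced_hypercube n k)}"
    by (auto simp: out_arcs_def)
  then have "out_degree (with_proj (enhanced_hypercube n k)) x
      = (\<Sum>x' | (x, x') \<in> parcs (enhanced_hypercube n k). 1)"
    by (simp add: out_degree_def card_image inj_on_def)
  then show ?thesis by (simp only: sum_neighbours[OF assms]) simp
qed

text \<open>Half of the eigenvalue 2 * (a + b) + 1 - (-1)^b of the character \<open>y\<close>. As a
  natural number it can be counted before any passage to the complex numbers.\<close>

definition half_eigenvalue :: "nat \<Rightarrow> bool list \<Rightarrow> nat" where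
  "half_eigenvalue k y = weight y + of_bool (odd (weight (drop (k - 1) y)))"

text \<open>Each coordinate flip multiplies the character by a sign, and these signs add up to
  \<open>n - 2 * weight y\<close>; the remaining edge multiplies it by (-1)^b, where b is the weight
  of the tail. Both are subtracted from the degree n + 1.\<close>

lemma laplacian_character:
  assumes "1 \<le> k" "k \<le> n - 1" "length x = n" "length y = n"
  shows "of_nat (n + 1) * character n y x
      - (\<Sum>x' | (x, x') \<in> parcs (enhanced_hypercube n k). character n y x')
    = of_nat (2 * half_eigenvalue k y) * character n y x"
proof -
  have "(\<Sum>i = 1..n. character n y (flip_coord i x))
      = (\<Sum>i = 1..n. (if y ! (i - 1) then - 1 else 1) * character n y x)"
    using assms(3) by (intro sum.cong refl character_flip_coord)
  also have "\<dots> = (\<Sum>i = 0..<length y. (if y ! i then - 1 else 1) * character n y x)"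
    using assms(4)
    by (intro sum.reindex_bij_witness[where i = Suc and j = "\<lambda>i. i - 1"]) auto
  also have "\<dots> = (\<Sum>i = 0..<length y. if y ! i then - 1 else 1) * character n y x"
    by (rule sum_distrib_right[symmetric])
  also have "\<dots> = (of_nat n - 2 * of_nat (weight y)) * character n y x"
    by (simp only: sum_sign_eq_weight) (simp only: assms(4))
  finally show ?thesis
    using assms
    by (auto simp: sum_neighbours character_flip_from half_eigenvalue_def algebra_simps)
qed

lemma laplacian_spectrum_eq_half_eigenvalues:
  assumes k: "1 \<le> k" "k \<le> n - 1"
    and vs: "distinct vs" "set vs = pverts (enhanced_hypercube n k)"
  shows "laplacian_spectrum (enhanced_hypercube n k) vs
    = image_mset (\<lambda>y. of_nat (2 * half_eigenvalue k y)) (mset_set {y. length y = n})"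
proof -
  let ?G = "enhanced_hypercube n k"
  let ?N = "length vs"
  let ?L = "laplacian_matrix ?G vs"
  let ?d = "\<lambda>i. of_nat (2 * half_eigenvalue k (vs ! i)) :: complex"
  \<comment> \<open>Rows stand for points and columns for characters. Both are labelled by binary
    vectors, so the one enumeration \<open>vs\<close> serves for both; the inverse \<open>Q\<close>
    is \<open>P\<close> divided by the group order.\<close>
  define P where "P = mat ?N ?N (\<lambda>(i, j). character n (vs ! j) (vs ! i))"
  define Q where "Q = mat ?N ?N (\<lambda>(i, j). character n (vs ! j) (vs ! i) / 2 ^ n)"
  have set_vs: "set vs = {x. length x = n}"
    using vs(2) by (simp add: enhanced_hypercube_def)
  have len: "length (vs ! i) = n" if "i < ?N" for i
    using that set_vs nth_mem by blast
  have sum_vs: "(\<Sum>i = 0..<?N. f (vs ! i)) = (\<Sum>x | length x = n. f x)" for f :: "_ \<Rightarrow> complex"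
    using sum.reindex_bij_betw[OF bij_betw_nth[OF vs(1) refl set_vs[symmetric]], of f]
    by (simp add: atLeast0LessThan)
  have "P * Q = 1\<^sub>m ?N"
  proof (rule eq_matI)
    fix i j assume "i < dim_row (1\<^sub>m ?N)" "j < dim_col (1\<^sub>m ?N)"
    then have ij: "i < ?N" "j < ?N" by auto
    then have "(P * Q) $$ (i, j)
        = (\<Sum>l = 0..<?N. character n (vs ! l) (vs ! i) * (character n (vs ! j) (vs ! l) / 2 ^ n))"
      by (simp add: P_def Q_def scalar_prod_def)
    also have "\<dots> = (\<Sum>l = 0..<?N. character n (vs ! i) (vs ! l) * character n (vs ! j) (vs ! l)) / 2 ^ n"
      by (simp add: sum_divide_distrib character_commute[of n _ "vs ! i"])
    also have "\<dots> = (if vs ! i = vs ! j then 1 else 0)"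
      using ij by (subst sum_vs) (simp add: sum_character_mult len)
    finally show "(P * Q) $$ (i, j) = 1\<^sub>m ?N $$ (i, j)"
      using ij vs(1) by (simp add: nth_eq_iff_index_eq)
  qed (auto simp: P_def Q_def)
  moreover have "?L * P = P * mat_diag ?N ?d"
  proof (rule eq_matI)
    fix i j assume "i < dim_row (P * mat_diag ?N ?d)" "j < dim_col (P * mat_diag ?N ?d)"
    then have ij: "i < ?N" "j < ?N" by (auto simp: P_def mat_diag_def)
    let ?c = "character n (vs ! j)"
    have "(?L * P) $$ (i, j) = (\<Sum>l = 0..<?N.
        ((if i = l then of_nat (out_degree (with_proj ?G) (vs ! i)) else 0)
          - (if (vs ! i, vs ! l) \<in> parcs ?G then 1 else 0)) * ?c (vs ! l))"
      using ij by (simp add: P_def laplacian_matrix_def degree_matrix_def adjacency_matrix_def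
        scalar_prod_def)
    also have "\<dots> = (\<Sum>l = 0..<?N. if i = l then of_nat (n + 1) * ?c (vs ! i) else 0)
        - (\<Sum>l = 0..<?N. if (vs ! i, vs ! l) \<in> parcs ?G then ?c (vs ! l) else 0)"
      using ij k len
      by (subst sum_subtractf[symmetric])
        (auto simp: out_degree_enhanced_hypercube left_diff_distrib intro!: sum.cong)
    also have "(\<Sum>l = 0..<?N. if i = l then of_nat (n + 1) * ?c (vs ! i) else 0)
        = of_nat (n + 1) * ?c (vs ! i)"
      using ij by simp
    also have "(\<Sum>l = 0..<?N. if (vs ! i, vs ! l) \<in> parcs ?G then ?c (vs ! l) else 0)
        = (\<Sum>x | length x = n. if (vs ! i, x) \<in> parcs ?G then ?c x else 0)"
      by (rule sum_vs)
    also have "\<dots> = (\<Sum>x | (vs ! i, x) \<in> parcs ?G. ?c x)"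
      by (rule sum.mono_neutral_cong_right)
        (auto simp: finite_bool_lists enhanced_hypercube_def flip_coord_props flip_from_props)
    also have "of_nat (n + 1) * ?c (vs ! i) - \<dots> = ?d j * ?c (vs ! i)"
      using ij k len by (intro laplacian_character) auto
    finally show "(?L * P) $$ (i, j) = (P * mat_diag ?N ?d) $$ (i, j)"
      using ij by (subst mat_diag_mult_right[of _ ?N ?N]) (auto simp: P_def)
  qed (auto simp: P_def mat_diag_def laplacian_matrix_def degree_matrix_def adjacency_matrix_def)
  ultimately have "laplacian_spectrum ?G vs = mset (map ?d [0..<?N])"
    unfolding laplacian_spectrum_def
    by (intro proots_char_poly_eigenbasis[of _ _ P Q])
      (auto simp: P_def Q_def laplacian_matrix_def degree_matrix_def adjacency_matrix_def)
  also have "map ?d [0..<?N] = map (\<lambda>y. of_nat (2 * half_eigenvalue k y)) vs"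
    by (simp add: map_equality_iff)
  also have "mset \<dots> = image_mset (\<lambda>y. of_nat (2 * half_eigenvalue k y)) (mset_set (set vs))"
    using vs(1) by (simp add: mset_set_set)
  finally show ?thesis by (simp only: set_vs)
qed

subsection \<open>Multiplicities\<close>

lemma card_bool_lists_weight: "card {xs. length xs = n \<and> weight xs = w} = n choose w"
proof (induction n arbitrary: w)
  case 0
  have "{xs :: bool list. length xs = 0 \<and> weight xs = w} = (if w = 0 then {[]} else {})" by auto
  then show ?case by (simp only:) (simp add: binomial_eq_0)
next
  case (Suc n)
  let ?S = "\<lambda>w. {xs. length xs = n \<and> weight xs = w}"
  have fin: "finite (?S w)" for w
    by (rule finite_subset[OF _ finite_bool_lists[of n]]) auto
  have "{xs. length xs = Suc n \<and> weight xs = w}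
      = Cons False ` ?S w \<union> (if w = 0 then {} else Cons True ` ?S (w - 1))"
    by (auto simp: length_Suc_conv image_iff split: if_splits)
  also have "card \<dots> = card (?S w) + (if w = 0 then 0 else card (?S (w - 1)))"
    using fin by (subst card_Un_disjoint) (auto simp: card_image)
  also have "\<dots> = Suc n choose w"
    by (cases w) (simp_all only: Suc.IH, simp_all)
  finally show ?case .
qed

text \<open>For j > 0 the weights 2j - 1 and 2j round up to 2j, and Pascal's rule merges their two
  binomials. For j = 0 only weight 0 does.\<close>

lemma card_bool_lists_rounded_weight:
  "card {q. length q = m \<and> weight q + of_bool (odd (weight q)) = 2 * j} = Suc m choose (2 * j)"
proof (cases j)
  case 0
  have "{q. length q = m \<and> weight q + of_bool (odd (weight q)) = 0} = {q. length q = m \<and> weight q = 0}"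
    by auto
  then have "card {q. length q = m \<and> weight q + of_bool (odd (weight q)) = 0} = 1"
    by (simp only: card_bool_lists_weight binomial_n_0)
  then show ?thesis using 0 by (simp only: mult_0_right binomial_n_0)
next
  case (Suc i)
  let ?S = "\<lambda>w. {q. length q = m \<and> weight q = w}"
  have fin: "finite (?S w)" for w
    by (rule finite_subset[OF _ finite_bool_lists[of m]]) auto
  have "{q. length q = m \<and> weight q + of_bool (odd (weight q)) = 2 * j}
      = ?S (Suc (2 * i)) \<union> ?S (Suc (Suc (2 * i)))"
  proof -
    have "w + of_bool (odd w) = 2 * j \<longleftrightarrow> w = Suc (2 * i) \<or> w = Suc (Suc (2 * i))" for w
    proof (cases "odd w")
      case True
      then obtain a where "w = 2 * a + 1" by (rule oddE)
      then show ?thesis using Suc by auto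
    next
      case False
      then have "w \<noteq> Suc (2 * i)" by auto
      then show ?thesis using False Suc by auto
    qed
    then show ?thesis by auto
  qed
  also have "card \<dots> = (m choose Suc (2 * i)) + (m choose Suc (Suc (2 * i)))"
    using fin by (subst card_Un_disjoint) (auto simp: card_bool_lists_weight)
  finally show ?thesis using Suc by simp
qed

text \<open>Each vector is cut into a head of length k - 1 and a tail of length n - k + 1. If the
  tail weight rounds up to 2j, the head must have weight s - 2j, so the count is a sum of products
  over j.\<close>

lemma card_half_eigenvalue:
  assumes "1 \<le> k" "k \<le> n"
  shows "card {y. length y = n \<and> half_eigenvalue k y = s}
    = (\<Sum>j = 0..n. binom (n - k + 2) (2 * int j) * binom (k - 1) (int s - 2 * int j))"
proof -
  let ?m = "n - k + 1"
  \<comment> \<open>Stated with an addition, so that the set is empty when 2j exceeds s, in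
    agreement with the value 0 of \<open>binom\<close> at negative arguments.\<close>
  let ?p = "\<lambda>j. {p. length p = k - 1 \<and> weight p + 2 * j = s}"
  let ?q = "\<lambda>j. {q. length q = ?m \<and> weight q + of_bool (odd (weight q)) = 2 * j}"
  have fin: "finite (?p j)" "finite (?q j)" for j
    by (rule finite_subset[OF _ finite_bool_lists[of "k - 1"]], force)
      (rule finite_subset[OF _ finite_bool_lists[of ?m]], force)
  have card_p: "card (?p j) = binom (k - 1) (int s - 2 * int j)" for j
  proof (cases "2 * j \<le> s")
    case True
    then have "?p j = {p. length p = k - 1 \<and> weight p = s - 2 * j}" by auto
    with True show ?thesis
      by (simp add: card_bool_lists_weight binom_def nat_diff_distrib nat_mult_distrib)
  next
    case False
    then have "?p j = {}" by auto
    with False show ?thesis by (simp add: binom_def del: Collect_empty_eq)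
  qed
  have card_q: "card (?q j) = binom (n - k + 2) (2 * int j)" for j
    using card_bool_lists_rounded_weight[of ?m j] by (simp add: binom_def nat_mult_distrib)
  have "bij_betw (\<lambda>y. (take (k - 1) y, drop (k - 1) y))
      {y. length y = n \<and> half_eigenvalue k y = s} (\<Union>j\<in>{0..n}. ?p j \<times> ?q j)"
  proof (rule bij_betw_byWitness[where f' = "\<lambda>(p, q). p @ q"])
    show "(\<lambda>y. (take (k - 1) y, drop (k - 1) y)) ` {y. length y = n \<and> half_eigenvalue k y = s}
        \<subseteq> (\<Union>j\<in>{0..n}. ?p j \<times> ?q j)"
    proof (rule image_subsetI)
      fix y assume "y \<in> {y. length y = n \<and> half_eigenvalue k y = s}"
      then have y: "length y = n" "half_eigenvalue k y = s" by auto
      let ?u = "take (k - 1) y" and ?v = "drop (k - 1) y"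
      have w: "weight y = weight ?u + weight ?v"
        by (metis append_take_drop_id filter_append length_append)
      have v: "weight ?v \<le> n"
        using length_filter_le[of "\<lambda>b. b" ?v] y by simp
      obtain j where j: "weight ?v + of_bool (odd (weight ?v)) = 2 * j"
        by (metis dvd_def even_add odd_of_bool_self)
      \<comment> \<open>A nonzero weight at most doubles when rounded up, so 2j is at most 2n and
        the index range 0..n misses no tail.\<close>
      have "j \<le> n" using j v by (cases "odd (weight ?v)") auto
      moreover have "?u \<in> ?p j"
        using y w j assms by (auto simp: half_eigenvalue_def)
      moreover have "?v \<in> ?q j" using y j assms by auto
      ultimately show "(?u, ?v) \<in> (\<Union>j\<in>{0..n}. ?p j \<times> ?q j)" by auto
    qed
  qed (use assms in \<open>auto simp: half_eigenvalue_def\<close>)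
  then have "card {y. length y = n \<and> half_eigenvalue k y = s} = card (\<Union>j\<in>{0..n}. ?p j \<times> ?q j)"
    by (rule bij_betw_same_card)
  also have "\<dots> = (\<Sum>j = 0..n. card (?p j \<times> ?q j))"
    using fin by (intro card_UN_disjoint) auto
  also have "\<dots> = (\<Sum>j = 0..n. binom (n - k + 2) (2 * int j) * binom (k - 1) (int s - 2 * int j))"
    by (simp only: card_cartesian_product card_p card_q) (simp only: mult.commute)
  finally show ?thesis .
qed

section \<open>Evaluation of the multiplicities\<close>

lemma binom_0: "binom a 0 = 1"
  and binom_1: "binom a 1 = a"
  and binom_neg: "b < 0 \<Longrightarrow> binom a b = 0"
  and binom_gt: "int a < b \<Longrightarrow> binom a b = 0"
  by (auto simp: binom_def binomial_eq_0)

lemma binom_Suc: "binom (Suc a) b = binom a (b - 1) + binom a b"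
proof (cases "b \<le> 0")
  case False
  then have "nat b = Suc (nat (b - 1))" by simp
  with False show ?thesis by (simp add: binom_def)
qed (auto simp: binom_def)

lemma card_half_eigenvalue_0:
  assumes "1 \<le> k" "k \<le> n"
  shows "card {y. length y = n \<and> half_eigenvalue k y = 0} = 1"
  by (simp add: card_half_eigenvalue[OF assms] sum.atLeast_Suc_atMost binom_0 binom_neg)

text \<open>For j > 0 the lower argument 1 - 2j is negative, so only the term j = 0 survives. This
  is the multiplicity of the eigenvalue 2.\<close>

lemma card_half_eigenvalue_1:
  assumes "1 \<le> k" "k \<le> n"
  shows "card {y. length y = n \<and> half_eigenvalue k y = 1} = k - 1"
  by (simp add: card_half_eigenvalue[OF assms] sum.atLeast_Suc_atMost binom_0 binom_1 binom_neg)

lemma card_half_eigenvalue_mid: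
  assumes "1 \<le> k" "k \<le> n"
  shows "card {y. length y = n \<and> half_eigenvalue k y = t + 1} = gamma_mid n k t"
  by (simp add: card_half_eigenvalue[OF assms] gamma_mid_def add.commute)

text \<open>Only the all-ones vector can reach n + 1, and it does so exactly when n - k + 1 is odd.
  The general sum is matched with \<open>gamma_last\<close> term by term.\<close>

lemma card_half_eigenvalue_last:
  assumes "1 \<le> k" "k \<le> n"
  shows "card {y. length y = n \<and> half_eigenvalue k y = n + 1} = gamma_last n k"
proof -
  \<comment> \<open>A term is nonzero only if \<open>2 * j = n - k + 2\<close>, where the second summand of Pascal's rule
    vanishes.\<close>
  have "binom (n - k + 2) (2 * int j) * binom (k - 1) (int (n + 1) - 2 * int j)
      = binom (n - k + 1) (2 * int j - 1) * binom (k - 1) (int n - 2 * int j + 1)" for j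
  proof (cases "int (n - k + 1) < 2 * int j")
    case True
    then show ?thesis
      using binom_Suc[of "n - k + 1" "2 * int j"] by (simp add: binom_gt algebra_simps)
  next
    case False
    then have "int (k - 1) < int n + 1 - 2 * int j" using assms by auto
    then show ?thesis by (simp add: binom_gt algebra_simps)
  qed
  \<comment> \<open>In its rewritten form the term j = 0 has lower argument -1 and vanishes, so the
    sum may start at j = 1.\<close>
  then show ?thesis
    by (simp add: card_half_eigenvalue[OF assms] gamma_last_def sum.atLeast_Suc_atMost binom_neg)
qed

section \<open>Assembly of the spectrum\<close>

lemma half_eigenvalue_le: "length y = n \<Longrightarrow> half_eigenvalue k y \<le> n + 1"
  using length_filter_le[of "\<lambda>b. b" y] by (auto simp: half_eigenvalue_def)

text \<open>The elements of \<open>A\<close> are grouped by fibres of \<open>f\<close>. Values in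
  \<open>B\<close> that are not attained contribute an empty multiset, that is, multiplicity
  0.\<close>

lemma image_mset_eq_sum_replicate:
  assumes "finite A" "finite B" "f ` A \<subseteq> B"
  shows "image_mset f (mset_set A) = (\<Sum>b\<in>B. replicate_mset (card {a \<in> A. f a = b}) b)"
proof (rule multiset_eqI)
  fix c
  have "count (image_mset f (mset_set A)) c = card {a \<in> A. f a = c}"
    using assms(1) by (simp add: count_image_mset' eq_commute[of c])
  also have "\<dots> = (if c \<in> B then card {a \<in> A. f a = c} else 0)"
    using assms(3) by (auto simp: card_eq_0_iff)
  also have "\<dots> = count (\<Sum>b\<in>B. replicate_mset (card {a \<in> A. f a = b}) b) c"
    using assms(2) by (simp add: count_sum)
  finally show "count (image_mset f (mset_set A)) c = \<dots>" .
qed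

theorem theorem3:
  fixes n k :: nat and vs :: "bool list list"
  assumes "n \<ge> 2" and "1 \<le> k" and "k \<le> n - 1"
    and "distinct vs" and "set vs = pverts (enhanced_hypercube n k)"
  shows "laplacian_spectrum (enhanced_hypercube n k) vs =
    {#0#} + replicate_mset (k - 1) 2
      + (\<Sum>t=1..n - 1. replicate_mset (gamma_mid n k t) (of_nat (2 * t + 2)))
      + replicate_mset (gamma_last n k) (of_nat (2 * n + 2))"
proof -
  have kn: "1 \<le> k" "k \<le> n" using assms by auto
  let ?c = "\<lambda>s. card {y. length y = n \<and> half_eigenvalue k y = s}"
  let ?r = "\<lambda>s. replicate_mset (?c s) (of_nat (2 * s) :: complex)"
  have "laplacian_spectrum (enhanced_hypercube n k) vs = image_mset (\<lambda>s. of_nat (2 * s))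
      (image_mset (half_eigenvalue k) (mset_set {y. length y = n}))"
    using laplacian_spectrum_eq_half_eigenvalues[OF assms(2-5)]
    by (simp add: multiset.map_comp comp_def)
  also have "image_mset (half_eigenvalue k) (mset_set {y. length y = n})
      = (\<Sum>s = 0..n + 1. replicate_mset (?c s) s)"
    using half_eigenvalue_le[of _ n k]
    by (subst image_mset_eq_sum_replicate[where B = "{0..n + 1}"])
      (auto simp: finite_bool_lists simp del: sum.atLeast0_atMost_Suc)
  also have "image_mset (\<lambda>s. of_nat (2 * s)) \<dots> = (\<Sum>s = 0..n + 1. ?r s)"
    by (subst sum_comp_morphism[symmetric]) (simp_all add: comp_def)
  \<comment> \<open>The values 0, 1 and n + 1 have multiplicities of their own form. The middle
    range 2..n is written with + 1 at both ends to prepare the shift s = t + 1, which turns 2s into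
    2t + 2.\<close>
  also have "\<dots> = ?r 0 + ?r 1 + (\<Sum>s = 1 + 1..n - 1 + 1. ?r s) + ?r (n + 1)"
    using assms(1) by (simp add: sum.atLeast_Suc_atMost numeral_2_eq_2 add.assoc)
  also have "(\<Sum>s = 1 + 1..n - 1 + 1. ?r s) = (\<Sum>t = 1..n - 1. ?r (t + 1))"
    by (rule sum.shift_bounds_cl_nat_ivl)
  finally show ?thesis
    unfolding card_half_eigenvalue_0[OF kn] card_half_eigenvalue_1[OF kn]
      card_half_eigenvalue_last[OF kn] card_half_eigenvalue_mid[OF kn]
    by (simp add: algebra_simps)
qed

end
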